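(* Let $d\ge 2$ and $k\in\mathbb{N}$, and put $r:=dk+1$, $$T:=\{0,\ldots,k\}e_1\cup\bigcup_{i=2}^d\bigl(\{0,\ldots,k-1\}e_1+e_i\bigr),\qquad a:=\sum_{i=1}^d((i-1)k+1)e_i,$$ $$\mathbb{L}:=\{z\in\mathbb{Z}^d:\langle z,a\rangle\in r\mathbb{Z}\}.$$ Let $b_1^\ast,\ldots,b_d^\ast$ be the basis of the dual lattice $\mathbb{L}^\ast$ given by $b_i^\ast:=\frac1r a-\sum_{\ell=i+1}^d e_\ell$ for $i\in\{1,\ldots,d\}$, and let $b_{d+1}^\ast:=b_1^\ast+\cdots+b_d^\ast$. Then $\{\pm b_1^\ast,\ldots,\pm b_{d+1}^\ast\}\subseteq W(T,\mathbb{L})$.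
   Context: $\mathbb{N}=\{1,2,3,\ldots\}$; $o$ is the origin and $e_1,\ldots,e_d$ the standard basis of $\mathbb{R}^d$; $\langle\cdot,\cdot\rangle$ is the standard scalar product; $X+Y=\{x+y: x\in X,\ y\in Y\}$ and $Ab=\{tb:t\in A\}$ for $A\subseteq\mathbb{R}$, $b\in\mathbb{R}^d$. $\mathbb{L}$ is a lattice of rank $d$ in $\mathbb{R}^d$ (that is, of the form $\mathbb{Z}b_1+\cdots+\mathbb{Z}b_d$ with $b_1,\ldots,b_d$ linearly independent). The dual lattice is $\mathbb{L}^\ast=\{y\in\mathbb{R}^d:\langle y,x\rangle\in\mathbb{Z}\text{ for each }x\in\mathbb{L}\}$. The width function is $w(K,u)=\sup_{x\in K}\langle u,x\rangle-\inf_{x\in K}\langle u,x\rangle$, and $W(K,\mathbb{L})=\{u\in\mathbb{L}^\ast\setminus\{o\}: w(K,u)<1\}$. *)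

theory Defs
  imports "HOL-Analysis.Analysis"
begin

definition lattice_basis :: "nat \<Rightarrow> (nat \<Rightarrow> 'a::euclidean_space) \<Rightarrow> 'a set \<Rightarrow> bool" where
  "lattice_basis n b L \<longleftrightarrow>
     inj_on b {1..n} \<and> independent (b ` {1..n}) \<and>
     L = {\<Sum>i=1..n. of_int (c i) *\<^sub>R b i | c :: nat \<Rightarrow> int. True}"

definition full_rank_lattice :: "'a::euclidean_space set \<Rightarrow> bool" where
  "full_rank_lattice L \<longleftrightarrow> (\<exists>b. lattice_basis DIM('a) b L)"

definition dual_lattice :: "'a::euclidean_space set \<Rightarrow> 'a set" where
  "dual_lattice L = {y. \<forall>x\<in>L. y \<bullet> x \<in> \<int>}"

text \<open>The supremum and infimum are those of the reals, so the width is only meaningful for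
  nonempty bounded \<open>K\<close>; below it is applied to a nonempty finite set.\<close>

definition width :: "'a::euclidean_space set \<Rightarrow> 'a \<Rightarrow> real" where
  "width K u = (SUP x\<in>K. u \<bullet> x) - (INF x\<in>K. u \<bullet> x)"

definition W :: "'a::euclidean_space set \<Rightarrow> 'a set \<Rightarrow> 'a set" where
  "W K L = {u \<in> dual_lattice L - {0}. width K u < 1}"

text \<open>In the following, \<open>e 1, \<dots>, e d\<close> is meant to enumerate the standard basis of
  \<open>real ^ 'n\<close> (with \<open>d = CARD('n)\<close>); an explicit enumeration is needed because the
  index type \<open>'n\<close> carries no order.\<close>

definition T_set :: "(nat \<Rightarrow> real ^ 'n) \<Rightarrow> nat \<Rightarrow> nat \<Rightarrow> (real ^ 'n) set" where
  "T_set e d k =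
     {real j *\<^sub>R e 1 | j. j \<in> {0..k}} \<union>
     (\<Union>i\<in>{2..d}. {real j *\<^sub>R e 1 + e i | j. j \<in> {0..k - 1}})"

definition a_vec :: "(nat \<Rightarrow> real ^ 'n) \<Rightarrow> nat \<Rightarrow> nat \<Rightarrow> real ^ 'n" where
  "a_vec e d k = (\<Sum>i=1..d. real ((i - 1) * k + 1) *\<^sub>R e i)"

definition r_num :: "nat \<Rightarrow> nat \<Rightarrow> nat" where
  "r_num d k = d * k + 1"

definition L_set :: "(nat \<Rightarrow> real ^ 'n) \<Rightarrow> nat \<Rightarrow> nat \<Rightarrow> (real ^ 'n) set" where
  "L_set e d k =
     {z. (\<forall>i. z $ i \<in> \<int>) \<and> (\<exists>m::int. z \<bullet> a_vec e d k = real (r_num d k) * of_int m)}"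

definition b_star :: "(nat \<Rightarrow> real ^ 'n) \<Rightarrow> nat \<Rightarrow> nat \<Rightarrow> nat \<Rightarrow> real ^ 'n" where
  "b_star e d k i = (1 / real (r_num d k)) *\<^sub>R a_vec e d k - (\<Sum>l=i+1..d. e l)"

text \<open>The additional vector indexed by \<open>d + 1\<close> is the sum of the basis; it is not
  \<open>b_star e d k (d + 1)\<close>.\<close>

definition b_star_last :: "(nat \<Rightarrow> real ^ 'n) \<Rightarrow> nat \<Rightarrow> nat \<Rightarrow> real ^ 'n" where
  "b_star_last e d k = (\<Sum>i=1..d. b_star e d k i)"

end

theory Submission
  imports Defs
begin

text \<open>
  Put \<open>c\<^sub>j = k e\<^sub>1 + e\<^sub>j - e\<^sub>j\<^sub>+\<^sub>1\<close> for \<open>j \<le> d\<close>, reading \<open>e\<^sub>d\<^sub>+\<^sub>1\<close> as the origin. The coordinates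
  of \<open>a\<close> start at \<open>1\<close> and increase in steps of \<open>k\<close>, so \<open>\<langle>a, c\<^sub>j\<rangle> = 0\<close> for \<open>j < d\<close> and
  \<open>\<langle>a, c\<^sub>d\<rangle> = r\<close>; together with the telescoping of \<open>e\<^sub>j - e\<^sub>j\<^sub>+\<^sub>1\<close> against the tail sums
  \<open>e\<^sub>i\<^sub>+\<^sub>1 + \<dots> + e\<^sub>d\<close> this makes the vectors \<open>c\<^sub>j\<close> and the vectors \<open>b\<^sub>i\<^sup>*\<close> biorthogonal
  (lemma \<open>biorthogonal_b_star_L_basis\<close>).

  A vector lies in \<open>L\<close> exactly if its pairings with all \<open>b\<^sub>i\<^sup>*\<close> are integers, because the
  \<open>b\<^sub>i\<^sup>*\<close> generate the same group as \<open>a / r\<close> and the standard basis (lemma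
  \<open>L_set_eq_integral_pairing\<close>). For biorthogonal bases the vectors with integral
  pairings against one family are the integer combinations of the other
  (lemma \<open>biorthogonal_lattice_basis\<close>). Hence the \<open>c\<^sub>j\<close> form a basis of \<open>L\<close>, and the \<open>b\<^sub>i\<^sup>*\<close> form
  a basis of the dual lattice.

  The widths come from explicit bounds. On \<open>T\<close>, the functional \<open>b\<^sub>i\<^sup>*\<close> takes values between
  \<open>(ik + 1) / r - 1\<close> and \<open>ik / r\<close>, an interval of length \<open>1 - 1 / r\<close>. In the sum of all
  \<open>b\<^sub>i\<^sup>*\<close> the multiples of \<open>k\<close> cancel and the coefficient of \<open>e\<^sub>j\<close> is \<open>(d - j + 1) / r\<close>, so its values on
  \<open>T\<close> lie between \<open>0\<close> and \<open>dk / r = 1 - 1 / r\<close>.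
\<close>

section \<open>Biorthogonal bases and dual lattices\<close>

definition biorthogonal ::
  "nat \<Rightarrow> (nat \<Rightarrow> 'a::euclidean_space) \<Rightarrow> (nat \<Rightarrow> 'a) \<Rightarrow> bool" where
  "biorthogonal n b c \<longleftrightarrow>
     (\<forall>i\<in>{1..n}. \<forall>j\<in>{1..n}. b i \<bullet> c j = (if i = j then 1 else 0))"

lemma biorthogonal_sym: "biorthogonal n b c \<Longrightarrow> biorthogonal n c b"
  unfolding biorthogonal_def by (metis inner_commute)

lemma biorthogonal_inner_sum:
  assumes "biorthogonal n b c" and "i \<in> {1..n}"
  shows "b i \<bullet> (\<Sum>j=1..n. f j *\<^sub>R c j) = f i"
proof -
  have "b i \<bullet> (\<Sum>j=1..n. f j *\<^sub>R c j) = (\<Sum>j=1..n. f j * (if i = j then 1 else 0))"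
    using assms by (simp add: biorthogonal_def inner_sum_right)
  also have "\<dots> = f i"
    using assms(2) by (simp add: if_distrib cong: if_cong)
  finally show ?thesis .
qed

lemma biorthogonal_inj_on:
  assumes "biorthogonal n b c"
  shows "inj_on c {1..n}"
proof (rule inj_onI)
  fix i j
  assume ij: "i \<in> {1..n}" "j \<in> {1..n}" "c i = c j"
  then have "b i \<bullet> c j = 1"
    using assms by (metis biorthogonal_def)
  then show "i = j"
    using assms ij by (metis biorthogonal_def zero_neq_one)
qed

lemma biorthogonal_independent:
  assumes "biorthogonal n b c"
  shows "independent (c ` {1..n})"
proof (rule independent_if_scalars_zero)
  fix f x
  assume zero: "(\<Sum>x\<in>c ` {1..n}. f x *\<^sub>R x) = 0" and "x \<in> c ` {1..n}"
  then obtain i where i: "i \<in> {1..n}" "x = c i" by blast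
  have "(\<Sum>j=1..n. f (c j) *\<^sub>R c j) = 0"
    using zero biorthogonal_inj_on[OF assms] by (simp add: sum.reindex)
  then show "f x = 0"
    using biorthogonal_inner_sum[OF assms i(1), of "\<lambda>j. f (c j)"] i(2) by simp
qed simp

text \<open>The difference of the two sides is orthogonal to every \<open>b j\<close>; these vectors are
  independent and as many as the dimension, so they span the space.\<close>

lemma biorthogonal_expansion:
  fixes b c :: "nat \<Rightarrow> 'a::euclidean_space"
  assumes bi: "biorthogonal DIM('a) b c"
  shows "z = (\<Sum>j=1..DIM('a). (b j \<bullet> z) *\<^sub>R c j)"
proof -
  let ?B = "b ` {1..DIM('a)}"
  let ?w = "z - (\<Sum>j=1..DIM('a). (b j \<bullet> z) *\<^sub>R c j)"
  have bi': "biorthogonal DIM('a) c b" by (rule biorthogonal_sym[OF bi])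
  have "dim (UNIV :: 'a set) \<le> card ?B"
    using biorthogonal_inj_on[OF bi'] by (simp add: card_image)
  then have "?w \<in> span ?B"
    using card_ge_dim_independent[of ?B UNIV] biorthogonal_independent[OF bi'] by auto
  moreover have "orthogonal ?w y" if y: "y \<in> ?B" for y
  proof -
    obtain i where i: "i \<in> {1..DIM('a)}" "y = b i" using y by blast
    have "b i \<bullet> ?w = 0"
      by (simp only: inner_diff_right biorthogonal_inner_sum[OF bi i(1)] diff_self)
    then show ?thesis by (simp only: i(2) orthogonal_def inner_commute[of ?w])
  qed
  ultimately have "orthogonal ?w ?w"
    by (meson orthogonal_to_span)
  then show ?thesis by (simp add: orthogonal_self)
qed

text \<open>By the expansion the pairings with the \<open>b j\<close> are the coordinates with respect to the \<open>c j\<close>.\<close>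

lemma biorthogonal_lattice_basis:
  fixes b c :: "nat \<Rightarrow> 'a::euclidean_space"
  assumes bi: "biorthogonal DIM('a) b c"
  shows "lattice_basis DIM('a) c {z. \<forall>j\<in>{1..DIM('a)}. b j \<bullet> z \<in> \<int>}"
proof -
  have "\<exists>f :: nat \<Rightarrow> int. z = (\<Sum>j=1..DIM('a). of_int (f j) *\<^sub>R c j)"
    if z: "\<forall>j\<in>{1..DIM('a)}. b j \<bullet> z \<in> \<int>" for z
  proof
    have "(\<Sum>j=1..DIM('a). (b j \<bullet> z) *\<^sub>R c j) =
        (\<Sum>j=1..DIM('a). of_int \<lfloor>b j \<bullet> z\<rfloor> *\<^sub>R c j)"
      using z by (intro sum.cong) (auto elim!: Ints_cases)
    then show "z = (\<Sum>j=1..DIM('a). of_int \<lfloor>b j \<bullet> z\<rfloor> *\<^sub>R c j)"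
      using biorthogonal_expansion[OF bi, of z] by simp
  qed
  moreover have "b i \<bullet> (\<Sum>j=1..DIM('a). of_int (f j) *\<^sub>R c j) \<in> \<int>"
    if "i \<in> {1..DIM('a)}" for i and f :: "nat \<Rightarrow> int"
    using biorthogonal_inner_sum[OF bi that, of "\<lambda>j. of_int (f j)"] by simp
  ultimately show ?thesis
    using biorthogonal_inj_on[OF bi] biorthogonal_independent[OF bi]
    unfolding lattice_basis_def by auto
qed

lemma lattice_basis_mem:
  assumes "lattice_basis n c L" and "j \<in> {1..n}"
  shows "c j \<in> L"
proof -
  have "c j = (\<Sum>i=1..n. of_int (if i = j then 1 else 0) *\<^sub>R c i)"
    using assms(2) by (simp add: if_distrib if_distribR cong: if_cong)
  then have "\<exists>f :: nat \<Rightarrow> int. c j = (\<Sum>i=1..n. of_int (f i) *\<^sub>R c i)"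
    by (intro exI[of _ "\<lambda>i. if i = j then 1 else 0"])
  then show ?thesis
    using assms(1) unfolding lattice_basis_def by blast
qed

lemma dual_lattice_eq_integral_pairing:
  assumes "lattice_basis n c L"
  shows "dual_lattice L = {y. \<forall>j\<in>{1..n}. c j \<bullet> y \<in> \<int>}"
proof -
  have "y \<bullet> (\<Sum>i=1..n. of_int (f i) *\<^sub>R c i) \<in> \<int>"
    if "\<forall>j\<in>{1..n}. c j \<bullet> y \<in> \<int>" for y and f :: "nat \<Rightarrow> int"
    using that by (auto simp: inner_sum_right inner_commute[of y] intro!: Ints_mult)
  then have "{y. \<forall>j\<in>{1..n}. c j \<bullet> y \<in> \<int>} \<subseteq> dual_lattice L"
    using assms unfolding dual_lattice_def lattice_basis_def by blast
  moreover have "dual_lattice L \<subseteq> {y. \<forall>j\<in>{1..n}. c j \<bullet> y \<in> \<int>}"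
    using lattice_basis_mem[OF assms] by (auto simp: dual_lattice_def inner_commute)
  ultimately show ?thesis by blast
qed

section \<open>Membership in the set of short dual vectors\<close>

lemma uminus_mem_dual_lattice:
  assumes "u \<in> dual_lattice L"
  shows "- u \<in> dual_lattice L"
  using assms by (simp add: dual_lattice_def)

lemma width_le:
  assumes "K \<noteq> {}" and "\<And>x. x \<in> K \<Longrightarrow> m \<le> u \<bullet> x \<and> u \<bullet> x \<le> M"
  shows "width K u \<le> M - m"
proof -
  have "(SUP x\<in>K. u \<bullet> x) \<le> M" "m \<le> (INF x\<in>K. u \<bullet> x)"
    using assms by (auto intro: cSUP_least cINF_greatest)
  then show ?thesis by (simp add: width_def)
qed

lemma pm_mem_W:
  assumes "u \<in> dual_lattice L" and "u \<noteq> 0" and "K \<noteq> {}"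
    and bounds: "\<And>x. x \<in> K \<Longrightarrow> m \<le> u \<bullet> x \<and> u \<bullet> x \<le> M"
    and "M - m < 1"
  shows "{u, - u} \<subseteq> W K L"
proof -
  have "width K u \<le> M - m"
    by (rule width_le[OF assms(3) bounds])
  moreover have "width K (- u) \<le> - m - - M"
    by (rule width_le[OF assms(3)]) (use bounds in auto)
  ultimately show ?thesis
    using assms uminus_mem_dual_lattice[OF assms(1)] by (auto simp: W_def)
qed

section \<open>A basis of the lattice and its dual\<close>

lemma enumerated_Basis_inner:
  fixes e :: "nat \<Rightarrow> 'a::euclidean_space"
  assumes "bij_betw e {1..d} Basis"
    and "i \<in> {1..d}" and "j \<in> {1..d}"
  shows "e i \<bullet> e j = (if i = j then 1 else 0)"
proof -
  have "e i \<in> Basis" "e j \<in> Basis" "e i = e j \<longleftrightarrow> i = j"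
    using bij_betwE[OF assms(1)] assms(2,3) inj_on_eq_iff[OF bij_betw_imp_inj_on[OF assms(1)]]
    by blast+
  then show ?thesis by (simp add: inner_Basis)
qed

lemma enumerated_Basis_inner_sum:
  fixes e :: "nat \<Rightarrow> 'a::euclidean_space"
  assumes "bij_betw e {1..d} Basis"
    and "A \<subseteq> {1..d}" and "j \<in> {1..d}"
  shows "(\<Sum>l\<in>A. f l *\<^sub>R e l) \<bullet> e j = (if j \<in> A then f j else 0)"
proof -
  have "finite A" using assms(2) by (rule finite_subset) simp
  have "(\<Sum>l\<in>A. f l *\<^sub>R e l) \<bullet> e j = (\<Sum>l\<in>A. f l * (if l = j then 1 else 0))"
    unfolding inner_sum_left
    using assms enumerated_Basis_inner[OF assms(1)] by (intro sum.cong) auto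
  also have "\<dots> = (if j \<in> A then f j else 0)"
    using \<open>finite A\<close> by (simp add: if_distrib cong: if_cong)
  finally show ?thesis .
qed

lemma r_num_eq: "real (r_num d k) = real d * real k + 1"
  by (simp add: r_num_def)

lemma r_num_pos: "0 < real (r_num d k)"
  unfolding of_nat_0_less_iff by (simp add: r_num_def)

context
  fixes e :: "nat \<Rightarrow> real ^ 'n" and d k :: nat
  assumes e: "bij_betw e {1..d} (Basis :: (real ^ 'n) set)"
begin

lemma d_eq_DIM: "d = DIM(real ^ 'n)"
  using bij_betw_same_card[OF e] by simp

lemma d_pos: "1 \<le> d"
  using d_eq_DIM DIM_positive[where 'a = "real ^ 'n"] by linarith

lemma a_vec_inner:
  assumes "j \<in> {1..d}"
  shows "a_vec e d k \<bullet> e j = (real j - 1) * real k + 1"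
proof -
  have "a_vec e d k \<bullet> e j = real ((j - 1) * k + 1)"
    unfolding a_vec_def enumerated_Basis_inner_sum[OF e subset_refl assms] using assms by simp
  also have "\<dots> = (real j - 1) * real k + 1"
    using assms by simp
  finally show ?thesis .
qed

lemma b_star_inner:
  assumes "j \<in> {1..d}"
  shows "b_star e d k i \<bullet> e j =
    ((real j - 1) * real k + 1) / real (r_num d k) - (if i < j then 1 else 0)"
proof -
  have sub: "{i+1..d} \<subseteq> {1..d}" by auto
  have "(\<Sum>l=i+1..d. e l) \<bullet> e j = (if j \<in> {i+1..d} then 1 else 0)"
    using enumerated_Basis_inner_sum[OF e sub assms, of "\<lambda>_. 1"] by (simp only: scaleR_one)
  also have "\<dots> = (if i < j then 1 else (0::real))"
    using assms by auto
  finally have "(\<Sum>l=i+1..d. e l) \<bullet> e j = (if i < j then 1 else 0)" .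
  then show ?thesis
    by (simp add: b_star_def inner_diff_left a_vec_inner[OF assms])
qed

text \<open>The tail sums that contain \<open>e j\<close> are those of the \<open>j - 1\<close> indices below \<open>j\<close>, and
  \<open>d ((j - 1) k + 1) - (j - 1) (d k + 1) = d - j + 1\<close>.\<close>

lemma b_star_last_inner:
  assumes "j \<in> {1..d}"
  shows "b_star_last e d k \<bullet> e j = (real d - real j + 1) / real (r_num d k)"
proof -
  have "(\<Sum>i=1..d. if i < j then 1 else (0::real)) = (\<Sum>i\<in>{1..<j}. 1)"
    using assms by (intro sum.mono_neutral_cong_right) auto
  then have count: "(\<Sum>i=1..d. if i < j then 1 else (0::real)) = real j - 1"
    using assms by simp
  have "b_star_last e d k \<bullet> e j =
      real d * (((real j - 1) * real k + 1) / real (r_num d k)) - (real j - 1)"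
    unfolding b_star_last_def inner_sum_left b_star_inner[OF assms] sum_subtractf count by simp
  also have "\<dots> = (real d - real j + 1) / real (r_num d k)"
    by (simp add: r_num_def divide_simps add_nonneg_eq_0_iff) (simp add: algebra_simps)
  finally show ?thesis .
qed

text \<open>The case distinction lets \<open>e (d + 1)\<close>, on which the enumeration says nothing, count as the
  origin.\<close>

definition L_basis :: "nat \<Rightarrow> real ^ 'n" where
  "L_basis j = real k *\<^sub>R e 1 + e j - (if j < d then e (j + 1) else 0)"

lemma biorthogonal_b_star_L_basis: "biorthogonal d (b_star e d k) L_basis"
  unfolding biorthogonal_def
proof (intro ballI)
  fix i j
  assume i: "i \<in> {1..d}" and j: "j \<in> {1..d}"
  have one: "1 \<in> {1..d}" using d_pos by simp
  note r = r_num_eq[of d k] r_num_pos[of d k]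
  show "b_star e d k i \<bullet> L_basis j = (if i = j then 1 else 0)"
  proof (cases "j < d")
    case True
    then have "j + 1 \<in> {1..d}" by simp
    then have "b_star e d k i \<bullet> L_basis j =
        (if i < j + 1 then 1 else 0) - (if i < j then 1 else 0)"
      using True i r(2)
      by (simp add: L_basis_def inner_add_right inner_diff_right b_star_inner[OF one]
          b_star_inner[OF j] b_star_inner field_simps)
    then show ?thesis by auto
  next
    case False
    then have "j = d" using j by simp
    then have "b_star e d k i \<bullet> L_basis j =
        (real d * real k + 1) / real (r_num d k) - (if i < d then 1 else 0)"
      using i by (simp add: L_basis_def b_star_inner[OF one]
          b_star_inner[OF j[unfolded \<open>j = d\<close>]] add_divide_distrib[symmetric] algebra_simps
          del: One_nat_def)
    then show ?thesis using r i \<open>j = d\<close> by auto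
  qed
qed

lemma L_set_eq_coordinates:
  "L_set e d k = {z. (\<forall>j\<in>{1..d}. e j \<bullet> z \<in> \<int>) \<and> (a_vec e d k \<bullet> z) / real (r_num d k) \<in> \<int>}"
proof -
  have coords: "(\<forall>i. z $ i \<in> \<int>) \<longleftrightarrow> (\<forall>j\<in>{1..d}. e j \<bullet> z \<in> \<int>)" for z :: "real ^ 'n"
  proof -
    have "(\<forall>j\<in>{1..d}. e j \<bullet> z \<in> \<int>) \<longleftrightarrow> (\<forall>v\<in>Basis. v \<bullet> z \<in> \<int>)"
      using e by (metis (no_types, lifting) bij_betw_def imageE imageI)
    also have "\<dots> \<longleftrightarrow> (\<forall>i. z $ i \<in> \<int>)"
      by (auto simp: Basis_vec_def inner_axis' )
    finally show ?thesis by simp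
  qed
  have "real (r_num d k) \<noteq> 0" using r_num_pos[of d k] by simp
  then have "(\<exists>m::int. z \<bullet> a_vec e d k = real (r_num d k) * of_int m) \<longleftrightarrow>
      (a_vec e d k \<bullet> z) / real (r_num d k) \<in> \<int>" for z
    by (auto simp: Ints_def field_simps inner_commute[of z])
  then show ?thesis
    unfolding L_set_def coords by simp
qed

text \<open>The vectors \<open>b_star e d k i\<close> generate the same group as \<open>a / r\<close> and the \<open>e j\<close>:
  the last one is \<open>a / r\<close>, consecutive differences give \<open>e 2, \<dots>, e d\<close>, and \<open>e 1\<close> is
  obtained from \<open>a\<close>, where its coefficient is \<open>1\<close>.\<close>

lemma L_set_eq_integral_pairing:
  "L_set e d k = {z. \<forall>i\<in>{1..d}. b_star e d k i \<bullet> z \<in> \<int>}"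
proof (intro set_eqI iffI)
  fix z
  assume "z \<in> L_set e d k"
  then show "z \<in> {z. \<forall>i\<in>{1..d}. b_star e d k i \<bullet> z \<in> \<int>}"
    unfolding L_set_eq_coordinates b_star_def
    by (auto simp: inner_diff_left inner_sum_left intro!: Ints_diff)
next
  fix z
  assume "z \<in> {z. \<forall>i\<in>{1..d}. b_star e d k i \<bullet> z \<in> \<int>}"
  then have z: "b_star e d k i \<bullet> z \<in> \<int>" if "i \<in> {1..d}" for i
    using that by blast
  have r: "real (r_num d k) \<noteq> 0" using r_num_pos[of d k] by simp
  have a_div: "(a_vec e d k \<bullet> z) / real (r_num d k) \<in> \<int>"
    using z[of d] d_pos by (simp add: b_star_def)
  have tail: "e j \<bullet> z \<in> \<int>" if j: "j \<in> {2..d}" for j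
  proof -
    have "(\<Sum>l=j..d. e l) = e j + (\<Sum>l=j+1..d. e l)"
      using j by (simp add: sum.atLeast_Suc_atMost)
    then have "e j = b_star e d k j - b_star e d k (j - 1)"
      using j by (simp add: b_star_def)
    moreover have "b_star e d k j \<bullet> z - b_star e d k (j - 1) \<bullet> z \<in> \<int>"
      using j by (intro Ints_diff z) auto
    ultimately show ?thesis
      by (simp only: inner_diff_left)
  qed
  have head: "e 1 \<bullet> z \<in> \<int>"
  proof -
    have "a_vec e d k = e 1 + (\<Sum>i=2..d. real ((i - 1) * k + 1) *\<^sub>R e i)"
      unfolding a_vec_def using d_pos by (simp add: sum.atLeast_Suc_atMost numeral_2_eq_2)
    then have "e 1 = a_vec e d k - (\<Sum>i=2..d. real ((i - 1) * k + 1) *\<^sub>R e i)"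
      by simp
    then have "e 1 \<bullet> z = a_vec e d k \<bullet> z - (\<Sum>i=2..d. real ((i - 1) * k + 1) * (e i \<bullet> z))"
      by (simp only: inner_diff_left inner_sum_left inner_scaleR_left)
    moreover have "(\<Sum>i=2..d. real ((i - 1) * k + 1) * (e i \<bullet> z)) \<in> \<int>"
      using tail by (intro Ints_sum Ints_mult Ints_of_nat) auto
    moreover have "a_vec e d k \<bullet> z \<in> \<int>"
      using Ints_mult[OF Ints_of_nat[of "r_num d k"] a_div] r by simp
    ultimately show ?thesis by simp
  qed
  have "e j \<bullet> z \<in> \<int>" if "j \<in> {1..d}" for j
    using tail[of j] head that by (cases "j = 1") auto
  then show "z \<in> L_set e d k"
    using a_div by (simp add: L_set_eq_coordinates)
qed

lemma lattice_basis_L_set: "lattice_basis d L_basis (L_set e d k)"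
  using biorthogonal_lattice_basis[of "b_star e d k" L_basis, folded d_eq_DIM] biorthogonal_b_star_L_basis
  unfolding L_set_eq_integral_pairing by blast

lemma lattice_basis_dual_L_set:
  "lattice_basis d (b_star e d k) (dual_lattice (L_set e d k))"
  using biorthogonal_lattice_basis[of L_basis "b_star e d k", folded d_eq_DIM]
    biorthogonal_sym[OF biorthogonal_b_star_L_basis]
  unfolding dual_lattice_eq_integral_pairing[OF lattice_basis_L_set] by blast

section \<open>Values of the dual vectors on the configuration\<close>

lemma T_set_cases:
  assumes "x \<in> T_set e d k" and "1 \<le> k"
  obtains (axis) t where "x = real t *\<^sub>R e 1" and "real t \<le> real k"
  | (shifted) t i where "x = real t *\<^sub>R e 1 + e i" and "real t \<le> real k - 1" and "i \<in> {2..d}"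
  using assms unfolding T_set_def by fastforce

text \<open>The values of \<open>a / r\<close> on \<open>T\<close> are the numbers \<open>m / r\<close> with \<open>0 \<le> m \<le> dk\<close>: the points on the axis
  account for \<open>m \<le> k\<close>, and the translate by \<open>e j\<close> for \<open>(j - 1) k < m \<le> jk\<close>. Subtracting the
  tail sum lowers exactly the values with \<open>m > ik\<close> by \<open>1\<close>.\<close>

lemma b_star_bounds_T_set:
  assumes k: "1 \<le> k" and i: "i \<in> {1..d}" and x: "x \<in> T_set e d k"
  shows "(real i * real k + 1) / real (r_num d k) - 1 \<le> b_star e d k i \<bullet> x \<and>
    b_star e d k i \<bullet> x \<le> real i * real k / real (r_num d k)"
proof -
  have one: "1 \<in> {1..d}" using d_pos by simp
  note r = r_num_eq[of d k] r_num_pos[of d k]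
  have b1: "b_star e d k i \<bullet> e 1 = 1 / real (r_num d k)"
    using i b_star_inner[OF one] by simp
  have id: "real i * real k \<le> real d * real k"
    using i by (intro mult_right_mono) auto
  have ik: "real k \<le> real i * real k"
    using i mult_right_mono[of 1 "real i" "real k"] by simp
  have le_one: "(real i * real k + 1) / real (r_num d k) \<le> 1"
    using id r by simp
  show ?thesis
    using x k
  proof (cases rule: T_set_cases)
    case (axis t)
    then have "b_star e d k i \<bullet> x = real t / real (r_num d k)"
      by (simp add: b1 del: One_nat_def)
    moreover have "real t / real (r_num d k) \<le> real i * real k / real (r_num d k)"
      using axis(2) ik by (intro divide_right_mono) auto
    moreover have "0 \<le> real t / real (r_num d k)" by simp
    ultimately show ?thesis using le_one by linarith
  next
    case (shifted t j)
    then have j: "j \<in> {1..d}" by simp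
    have jd: "real j * real k \<le> real d * real k"
      using j by (intro mult_right_mono) auto
    have jk: "real k \<le> real j * real k"
      using j mult_right_mono[of 1 "real j" "real k"] by simp
    let ?v = "real t + real j * real k - real k + 1"
    have val: "b_star e d k i \<bullet> x = ?v / real (r_num d k) - (if i < j then 1 else 0)"
      unfolding shifted(1)
      by (simp add: inner_add_right b1 b_star_inner[OF j] add_divide_distrib[symmetric]
          left_diff_distrib del: One_nat_def)
    show ?thesis
    proof (cases "i < j")
      case True
      then have "real (i + 1) * real k \<le> real j * real k"
        by (intro mult_right_mono) auto
      then have "real i * real k + 1 \<le> ?v"
        by (simp add: distrib_right)
      then have "(real i * real k + 1) / real (r_num d k) \<le> ?v / real (r_num d k)"
        by (rule divide_right_mono) simp
      moreover have "?v \<le> real (r_num d k)"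
        using shifted(2) jd r(1) by linarith
      then have "?v / real (r_num d k) \<le> 1"
        using r(2) by simp
      moreover have "0 \<le> real i * real k / real (r_num d k)" by simp
      ultimately show ?thesis
        unfolding val if_P[OF True] by linarith
    next
      case False
      then have "real j * real k \<le> real i * real k"
        by (intro mult_right_mono) auto
      then have "?v \<le> real i * real k"
        using shifted(2) by linarith
      then have "?v / real (r_num d k) \<le> real i * real k / real (r_num d k)"
        by (rule divide_right_mono) simp
      moreover have "0 \<le> ?v"
        using jk by linarith
      then have "0 \<le> ?v / real (r_num d k)" by simp
      ultimately show ?thesis
        using le_one unfolding val if_not_P[OF False] by linarith
    qed
  qed
qed

lemma b_star_last_bounds_T_set:
  assumes k: "1 \<le> k" and x: "x \<in> T_set e d k"
  shows "0 \<le> b_star_last e d k \<bullet> x \<and>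
    b_star_last e d k \<bullet> x \<le> real d * real k / real (r_num d k)"
proof -
  have one: "1 \<in> {1..d}" using d_pos by simp
  have b1: "b_star_last e d k \<bullet> e 1 = real d / real (r_num d k)"
    using b_star_last_inner[OF one] by simp
  show ?thesis
    using x k
  proof (cases rule: T_set_cases)
    case (axis t)
    then have "real t * real d \<le> real d * real k"
      by (simp add: mult.commute mult_left_mono)
    moreover have "b_star_last e d k \<bullet> x = real t * real d / real (r_num d k)"
      by (simp only: axis(1) inner_scaleR_right b1 times_divide_eq_right)
    ultimately show ?thesis
      by (simp add: divide_right_mono)
  next
    case (shifted t j)
    then have j: "j \<in> {1..d}" by simp
    have "real t * real d \<le> (real k - 1) * real d"
      using shifted(2) by (rule mult_right_mono) simp
    then have le: "real t * real d + (real d - real j + 1) \<le> real d * real k"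
      using j by (simp add: algebra_simps)
    have "0 \<le> real t * real d" by simp
    then have nonneg: "0 \<le> real t * real d + (real d - real j + 1)"
      using j by (auto intro: add_nonneg_nonneg)
    have "b_star_last e d k \<bullet> x = (real t * real d + (real d - real j + 1)) / real (r_num d k)"
      unfolding shifted(1)
      by (simp add: inner_add_right b1 b_star_last_inner[OF j] add_divide_distrib[symmetric]
          del: One_nat_def)
    then show ?thesis
      using divide_right_mono[OF le, of "real (r_num d k)"] nonneg by simp
  qed
qed

lemma T_set_nonempty: "T_set e d k \<noteq> {}"
  unfolding T_set_def by fastforce

lemma pm_b_star_mem_W:
  assumes "1 \<le> k" and i: "i \<in> {1..d}"
  shows "{b_star e d k i, - b_star e d k i} \<subseteq> W (T_set e d k) (L_set e d k)"
proof (rule pm_mem_W)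
  show "b_star e d k i \<in> dual_lattice (L_set e d k)"
    by (rule lattice_basis_mem[OF lattice_basis_dual_L_set i])
  show "b_star e d k i \<noteq> 0"
    using biorthogonal_b_star_L_basis i unfolding biorthogonal_def by (metis inner_zero_left zero_neq_one)
  show "real i * real k / real (r_num d k) - ((real i * real k + 1) / real (r_num d k) - 1) < 1"
    using r_num_pos[of d k] by (simp add: divide_strict_right_mono)
qed (use T_set_nonempty b_star_bounds_T_set[OF assms] in auto)

lemma pm_b_star_last_mem_W:
  assumes "1 \<le> k"
  shows "{b_star_last e d k, - b_star_last e d k} \<subseteq> W (T_set e d k) (L_set e d k)"
proof (rule pm_mem_W)
  show "b_star_last e d k \<in> dual_lattice (L_set e d k)"
    using lattice_basis_mem[OF lattice_basis_dual_L_set]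
    by (auto simp: b_star_last_def dual_lattice_def inner_sum_left)
  have "b_star_last e d k \<bullet> e d \<noteq> 0"
    using b_star_last_inner[of d] d_pos r_num_pos[of d k] by simp
  then show "b_star_last e d k \<noteq> 0" by auto
  show "real d * real k / real (r_num d k) - 0 < 1"
    using r_num_pos[of d k] by (simp add: divide_less_eq r_num_eq)
qed (use T_set_nonempty b_star_last_bounds_T_set[OF assms] in auto)

end

theorem lemma5p4:
  fixes e :: "nat \<Rightarrow> real ^ 'n" and d k :: nat
  assumes "d \<ge> 2" and "k \<ge> 1"
    and "bij_betw e {1..d} (Basis :: (real ^ 'n) set)"
  shows "full_rank_lattice (L_set e d k) \<and>
    lattice_basis d (b_star e d k) (dual_lattice (L_set e d k)) \<and>
    (\<Union>i\<in>{1..d}. {b_star e d k i, - b_star e d k i}) \<union>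
      {b_star_last e d k, - b_star_last e d k} \<subseteq> W (T_set e d k) (L_set e d k)"
proof (intro conjI Un_least UN_least)
  show "full_rank_lattice (L_set e d k)"
    unfolding full_rank_lattice_def
    using lattice_basis_L_set[OF assms(3)] d_eq_DIM[OF assms(3)] by metis
qed (use lattice_basis_dual_L_set[OF assms(3)] pm_b_star_mem_W[OF assms(3,2)]
    pm_b_star_last_mem_W[OF assms(3,2)] in auto)

end
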